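(* As formal power series in $q$, $$\sum_{n\ge0}q^n\sum_{\lambda\vdash n}\prod_{u\in\lambda}\frac{c_{sp}^{\lambda}(u)}{h^{\lambda}(u)}=\prod_{j\ge1}\frac{1}{1+q^{4j-2}}=\sum_{n\ge0}q^n\sum_{\lambda\vdash n}\prod_{u\in\lambda}\frac{c_{O}^{\lambda}(u)}{h^{\lambda}(u)}.$$
   Context: For a partition $\lambda$ with conjugate $\lambda'$ (cells $(i,j)$ = row $i$, column $j$ of the Young diagram; $\lambda_i=0$ beyond the length): hook length $h^\lambda(i,j)=\lambda_i+\lambda'_j-i-j+1$; symplectic content $c^\lambda_{sp}(i,j)=\lambda_i+\lambda_j-i-j+2$ if $i>j$ and $c^\lambda_{sp}(i,j)=i+j-\lambda'_i-\lambda'_j$ if $i\le j$; orthogonal content $c^\lambda_O(i,j)=\lambda_i+\lambda_j-i-j$ if $i\ge j$ and $c^\lambda_O(i,j)=i+j-\lambda'_i-\lambda'_j-2$ if $i<j$. The empty partition contributes the empty product $1$ for $n=0$. *)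

theory Defs
  imports "HOL-Analysis.Infinite_Products" "HOL-Computational_Algebra.Formal_Power_Series"
begin

text \<open>
  A partition is the weakly decreasing list of its (positive) parts. Rows, columns and parts are
  numbered from 1, whereas list positions are numbered from 0.
\<close>

definition partitions_of :: "nat \<Rightarrow> nat list set" where
  "partitions_of n = {xs. sorted_wrt (\<ge>) xs \<and> (\<forall>x\<in>set xs. 0 < x) \<and> sum_list xs = n}"

definition part :: "nat list \<Rightarrow> nat \<Rightarrow> nat" where
  "part xs i = (if 1 \<le> i \<and> i \<le> length xs then xs ! (i - 1) else 0)"

definition cells :: "nat list \<Rightarrow> (nat \<times> nat) set" where
  "cells xs = {(i, j). 1 \<le> i \<and> i \<le> length xs \<and> 1 \<le> j \<and> j \<le> part xs i}"

text \<open>The \<open>j\<close>-th part of the conjugate partition, that is, the height of column \<open>j\<close>.\<close>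

definition conj_part :: "nat list \<Rightarrow> nat \<Rightarrow> nat" where
  "conj_part xs j = card {i. (i, j) \<in> cells xs}"

definition hook :: "nat list \<Rightarrow> nat \<Rightarrow> nat \<Rightarrow> int" where
  "hook xs i j = int (part xs i) + int (conj_part xs j) - int i - int j + 1"

definition sp_content :: "nat list \<Rightarrow> nat \<Rightarrow> nat \<Rightarrow> int" where
  "sp_content xs i j =
    (if i > j then int (part xs i) + int (part xs j) - int i - int j + 2
     else int i + int j - int (conj_part xs i) - int (conj_part xs j))"

definition orth_content :: "nat list \<Rightarrow> nat \<Rightarrow> nat \<Rightarrow> int" where
  "orth_content xs i j =
    (if i \<ge> j then int (part xs i) + int (part xs j) - int i - int j
     else int i + int j - int (conj_part xs i) - int (conj_part xs j) - 2)"

text \<open>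
  \<open>sum\<close> and \<open>prod\<close> over infinite sets default to 0 and 1; the next two facts show that this does
  not occur for the index sets used here.
\<close>

lemma finite_partitions_of: "finite (partitions_of n)"
proof (rule finite_subset)
  have "length xs \<le> sum_list xs" if "\<forall>x\<in>set xs. 0 < x" for xs :: "nat list"
    using that by (induction xs) auto
  then show "partitions_of n \<subseteq> {xs. set xs \<subseteq> {..n} \<and> length xs \<le> n}"
    using member_le_sum_list by (fastforce simp: partitions_of_def)
  show "finite {xs. set xs \<subseteq> {..n} \<and> length xs \<le> n}"
    by (rule finite_lists_length_le) simp
qed

lemma finite_cells: "finite (cells xs)"
proof -
  have "cells xs = (SIGMA i:{1..length xs}. {1..part xs i})"
    by (auto simp: cells_def)
  then show ?thesis by simp
qed

end

theory Submission
  imports Defs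
begin

text \<open>A partition is called balanced if column \<open>i\<close> is one cell longer than row \<open>i\<close> for every diagonal
  cell \<open>(i, i)\<close>. Symplectic contents and hook lengths differ, up to sign, only by a quantity
  attached to such a diagonal cell, so in a balanced partition every quotient of content and hook
  length is \<open>-1\<close> (\<open>i \<le> j\<close>) or \<open>1\<close> (\<open>i > j\<close>), and the product is \<open>(-1)\<close> to half the size. In an
  unbalanced partition some content vanishes. Peeling off the first hook, of size \<open>2k\<close>, shows that the
  balanced partitions have generating function \<open>\<Prod> (1 + x^k)\<close> with \<open>x = -q^2\<close>, and Euler's identity
  turns this into \<open>\<Prod> 1 / (1 - x^(2j-1))\<close>. Conjugation changes the sign of every content and exchanges
  the symplectic with the orthogonal ones.\<close>

unbundle no vec_syntax and fps_syntax

section \<open>Partitions and conjugation\<close>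

text \<open>Outside the rows of the list \<open>part\<close> defaults to 0, so no positive
  \<open>j\<close> fits and the bounds on \<open>i\<close> come for free.\<close>

lemma mem_cells_iff: "(i, j) \<in> cells xs \<longleftrightarrow> 1 \<le> j \<and> j \<le> part xs i"
  by (auto simp: cells_def part_def split: if_splits)

lemma part_antimono:
  assumes "sorted_wrt (\<ge>) xs" "1 \<le> i" "i \<le> k"
  shows "part xs k \<le> part xs i"
proof (cases "k \<le> length xs \<and> i < k")
  case True
  then have "xs ! (k - 1) \<le> xs ! (i - 1)"
    using sorted_wrt_nth_less[OF assms(1), of "i - 1" "k - 1"] assms True by auto
  then show ?thesis using True assms by (simp add: part_def)
next
  case False
  then show ?thesis using assms by (cases "i = k") (auto simp: part_def)
qed

text \<open>The rows meeting column \<open>j\<close> form an initial segment because row lengths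
  decrease, so their number is also the last such row. All later passages between rows and columns
  go through this equivalence.\<close>

lemma le_conj_part_iff:
  assumes "sorted_wrt (\<ge>) xs" "1 \<le> i" "1 \<le> j"
  shows "i \<le> conj_part xs j \<longleftrightarrow> j \<le> part xs i"
proof -
  define S where "S = {i. (i, j) \<in> cells xs}"
  have "S \<subseteq> {1..length xs}" by (auto simp: S_def cells_def)
  then have fin: "finite S" by (rule finite_subset) simp
  show ?thesis
  proof
    assume "j \<le> part xs i"
    then have "{1..i} \<subseteq> S"
      using part_antimono[OF assms(1)] assms(3) by (force simp: S_def mem_cells_iff)
    from card_mono[OF fin this] show "i \<le> conj_part xs j"
      by (simp add: conj_part_def S_def)
  next
    assume *: "i \<le> conj_part xs j"
    show "j \<le> part xs i"
    proof (rule ccontr)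
      assume neg: "\<not> j \<le> part xs i"
      have "S \<subseteq> {1..<i}"
      proof
        fix k assume "k \<in> S"
        then have k: "1 \<le> k" "j \<le> part xs k" by (auto simp: S_def cells_def)
        have "k < i"
          using part_antimono[OF assms(1,2), of k] k neg by force
        with k show "k \<in> {1..<i}" by simp
      qed
      from card_mono[OF _ this] have "card S \<le> i - 1" by simp
      with * assms(2) show False by (simp add: conj_part_def S_def)
    qed
  qed
qed

text \<open>Positivity excludes trailing zeros, so the length can be read off from the
  parts.\<close>

lemma partition_eqI:
  assumes "\<forall>x\<in>set xs. 0 < x" "\<forall>x\<in>set ys. 0 < x"
    and eq: "\<And>i. 1 \<le> i \<Longrightarrow> part xs i = part ys i"
  shows "xs = ys"
proof (rule nth_equalityI)
  have pos: "0 < part zs i \<longleftrightarrow> i \<le> length zs"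
    if "1 \<le> i" "\<forall>x\<in>set zs. 0 < x" for zs i
    using that by (auto simp: part_def)
  have "i \<le> length xs \<longleftrightarrow> i \<le> length ys" if "1 \<le> i" for i
    using pos[OF that assms(1)] pos[OF that assms(2)] eq[OF that] by simp
  from this[of "length xs"] this[of "length ys"]
  show len: "length xs = length ys"
    by (cases "xs = []"; cases "ys = []") (auto simp: Suc_le_eq)
  show "xs ! i = ys ! i" if "i < length xs" for i
    using eq[of "Suc i"] that len by (simp add: part_def)
qed

lemma card_cells: "card (cells xs) = sum_list xs"
proof -
  have "cells xs = (SIGMA i:{1..length xs}. {1..part xs i})"
    by (auto simp: cells_def)
  then have "card (cells xs) = (\<Sum>i=1..length xs. part xs i)" by simp
  also have "\<dots> = (\<Sum>i<length xs. xs ! i)"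
    by (rule sum.reindex_bij_witness[of _ Suc "\<lambda>i. i - 1"]) (auto simp: part_def)
  finally show ?thesis by (simp add: sum_list_sum_nth atLeast0LessThan)
qed

lemma hook_pos:
  assumes "sorted_wrt (\<ge>) xs" "(i, j) \<in> cells xs"
  shows "0 < hook xs i j"
  using le_conj_part_iff[OF assms(1), of i j] assms(2) by (auto simp: cells_def hook_def)

text \<open>Stopping at column \<open>part xs 1\<close>, the last nonempty one, keeps all entries
  positive.\<close>

definition conjugate :: "nat list \<Rightarrow> nat list" where
  "conjugate xs = map (conj_part xs) [1..<Suc (part xs 1)]"

lemma conj_part_eq_0:
  assumes "sorted_wrt (\<ge>) xs" "part xs 1 < j"
  shows "conj_part xs j = 0"
  using le_conj_part_iff[OF assms(1), of 1 j] assms(2) by linarith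

lemma part_conjugate:
  assumes "sorted_wrt (\<ge>) xs" "1 \<le> j"
  shows "part (conjugate xs) j = conj_part xs j"
  using assms conj_part_eq_0[OF assms(1), of j]
  by (auto simp: part_def conjugate_def simp del: upt_Suc)

lemma sorted_conjugate:
  assumes "sorted_wrt (\<ge>) xs"
  shows "sorted_wrt (\<ge>) (conjugate xs)"
proof -
  have "conj_part xs b \<le> conj_part xs a" if "1 \<le> a" "a \<le> b" for a b
  proof (cases "conj_part xs b = 0")
    case False
    then have "1 \<le> conj_part xs b" by simp
    then show ?thesis
      using le_conj_part_iff[OF assms, of "conj_part xs b"] that by (meson order_refl order_trans)
  qed simp
  then show ?thesis
    by (auto simp: conjugate_def sorted_wrt_iff_nth_less simp del: upt_Suc)
qed

lemma conjugate_pos: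
  assumes "sorted_wrt (\<ge>) xs"
  shows "\<forall>x\<in>set (conjugate xs). 0 < x"
  using le_conj_part_iff[OF assms, of 1]
  by (force simp: conjugate_def Suc_le_eq simp del: upt_Suc)

lemma cells_conjugate:
  assumes "sorted_wrt (\<ge>) xs"
  shows "(i, j) \<in> cells (conjugate xs) \<longleftrightarrow> (j, i) \<in> cells xs"
  using le_conj_part_iff[OF assms, of j i] part_conjugate[OF assms, of i]
  by (cases "i = 0"; cases "j = 0") (auto simp: cells_def part_def split: if_splits)

lemma conj_part_conjugate:
  assumes "sorted_wrt (\<ge>) xs" "1 \<le> j"
  shows "conj_part (conjugate xs) j = part xs j"
proof -
  have "{i. (i, j) \<in> cells (conjugate xs)} = {1..part xs j}"
    unfolding cells_conjugate[OF assms(1)] by (auto simp: mem_cells_iff)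
  then show ?thesis by (simp add: conj_part_def)
qed

lemma conjugate_conjugate:
  assumes "sorted_wrt (\<ge>) xs" "\<forall>x\<in>set xs. 0 < x"
  shows "conjugate (conjugate xs) = xs"
proof (rule partition_eqI)
  show "\<forall>x\<in>set (conjugate (conjugate xs)). 0 < x"
    by (intro conjugate_pos sorted_conjugate assms)
qed (simp_all add: assms sorted_conjugate part_conjugate conj_part_conjugate)

lemma bij_betw_swap_cells_conjugate:
  assumes "sorted_wrt (\<ge>) xs"
  shows "bij_betw prod.swap (cells xs) (cells (conjugate xs))"
  by (rule bij_betwI[of _ _ _ prod.swap]) (auto simp: cells_conjugate[OF assms])

lemma conjugate_in_partitions_of:
  assumes "xs \<in> partitions_of n"
  shows "conjugate xs \<in> partitions_of n"
  using assms bij_betw_same_card[OF bij_betw_swap_cells_conjugate, of xs]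
  by (auto simp: partitions_of_def sorted_conjugate conjugate_pos card_cells)

section \<open>Contents against hook lengths\<close>

definition balanced :: "nat list \<Rightarrow> bool" where
  "balanced xs \<longleftrightarrow> (\<forall>i. (i, i) \<in> cells xs \<longrightarrow> conj_part xs i = part xs i + 1)"

text \<open>Content plus hook (\<open>i \<le> j\<close>) and content minus hook
  (\<open>i > j\<close>) both equal \<open>part xs m - conj_part xs m + 1\<close> with m the smaller
  of \<open>i\<close> and \<open>j\<close>. The cell (m, m) lies in the diagram, so balance makes
  this 0.\<close>

lemma sp_content_eq_hook:
  assumes "sorted_wrt (\<ge>) xs" "balanced xs" "(i, j) \<in> cells xs"
  shows "sp_content xs i j = (if i \<le> j then - hook xs i j else hook xs i j)"
proof -
  have ij: "1 \<le> i" "1 \<le> j" "j \<le> part xs i" "i \<le> conj_part xs j"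
    using assms le_conj_part_iff[OF assms(1), of i j] by (auto simp: cells_def)
  show ?thesis
  proof (cases "i \<le> j")
    case True
    then have "(i, i) \<in> cells xs" using ij by (simp add: mem_cells_iff)
    then have "conj_part xs i = part xs i + 1" using assms(2) by (simp add: balanced_def)
    with True show ?thesis by (simp add: sp_content_def hook_def)
  next
    case False
    then have "(j, j) \<in> cells xs"
      using ij le_conj_part_iff[OF assms(1), of j j] by (simp add: mem_cells_iff)
    then have "conj_part xs j = part xs j + 1" using assms(2) by (simp add: balanced_def)
    with False show ?thesis by (simp add: sp_content_def hook_def)
  qed
qed

text \<open>The Maya diagram: read along the boundary, the vertical and the horizontal steps of a
  partition together occupy every integer.\<close>

lemma boundary_step_cases:
  assumes "sorted_wrt (\<ge>) xs"
  obtains k where "1 \<le> k" "int (part xs k) - int k = t"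
    | k where "1 \<le> k" "int (conj_part xs k) - int k = - t - 1"
proof -
  define Q where "Q k \<longleftrightarrow> 1 \<le> k \<and> int (part xs k) - int k \<le> t" for k
  define k where "k = (LEAST k. Q k)"
  \<comment> \<open>Below the last row \<open>part\<close> is 0, and the row number alone pushes the
    value under \<open>t\<close>.\<close>
  have "Q (Suc (length xs) + nat \<bar>t\<bar>)" by (auto simp: Q_def part_def)
  then have Qk: "Q k" unfolding k_def by (rule LeastI)
  have min: "\<not> Q l" if "l < k" for l using that unfolding k_def by (rule not_less_Least)
  show ?thesis
  proof (cases "int (part xs k) - int k = t")
    case True
    with Qk that(1) show ?thesis by (auto simp: Q_def)
  next
    case False
    \<comment> \<open>Row \<open>k\<close> ends before column \<open>j\<close>, while row
      \<open>k - 1\<close>, failing \<open>Q\<close>, reaches it. Hence column \<open>j\<close> has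
      height exactly \<open>k - 1\<close>.\<close>
    define j where "j = nat (t + int k)"
    have j: "int j = t + int k" "1 \<le> j" "part xs k < j"
      using False Qk by (auto simp: Q_def j_def)
    have "conj_part xs j < k"
      using le_conj_part_iff[OF assms, of k j] Qk j by (auto simp: Q_def)
    moreover have "k - 1 \<le> conj_part xs j"
    proof (cases "k = 1")
      case False
      then have "j \<le> part xs (k - 1)"
        using min[of "k - 1"] Qk j by (auto simp: Q_def)
      then show ?thesis
        using le_conj_part_iff[OF assms, of "k - 1" j] False Qk j by (auto simp: Q_def)
    qed simp
    ultimately have "int (conj_part xs j) - int j = - t - 1" using j(1) by simp
    with j(2) that(2) show ?thesis by blast
  qed
qed

text \<open>Among the unbalanced diagonal cells take the last one, \<open>(i, i)\<close>; its hook contains a cell of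
  content zero. The boundary alternative that does not provide one would provide an unbalanced
  diagonal cell further down.\<close>

lemma exists_sp_content_eq_0:
  assumes s: "sorted_wrt (\<ge>) xs" and "\<not> balanced xs"
  obtains i j where "(i, j) \<in> cells xs" "sp_content xs i j = 0"
proof -
  note conj = le_conj_part_iff[OF s]
  define B where "B = {i. (i, i) \<in> cells xs \<and> conj_part xs i \<noteq> part xs i + 1}"
  have "B \<subseteq> {1..length xs}" by (auto simp: B_def cells_def)
  then have fin: "finite B" by (rule finite_subset) simp
  have "B \<noteq> {}" using assms(2) by (auto simp: balanced_def B_def)
  define i where "i = Max B"
  have iB: "i \<in> B" unfolding i_def using fin \<open>B \<noteq> {}\<close> by (rule Max_in)
  have max: "conj_part xs k = part xs k + 1" if "i < k" "k \<le> part xs k" for k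
  proof (rule ccontr)
    assume "conj_part xs k \<noteq> part xs k + 1"
    then have "k \<in> B" using that by (simp add: B_def mem_cells_iff)
    then show False using Max_ge[OF fin, of k] that by (simp add: i_def)
  qed
  have i: "1 \<le> i" "i \<le> part xs i" "i \<le> conj_part xs i"
    using iB conj[of i i] by (auto simp: B_def cells_def)
  have anti: "part xs k \<le> part xs l" if "1 \<le> l" "l \<le> k" for l k
    using part_antimono[OF s] that by blast
  have conj_anti: "conj_part xs k \<le> conj_part xs l" if "1 \<le> l" "l \<le> k" for l k
    using part_antimono[OF sorted_conjugate[OF s], of l k] that part_conjugate[OF s] by simp
  have ne: "conj_part xs i \<noteq> part xs i + 1" using iB by (simp add: B_def)
  show ?thesis
  proof (cases "part xs i + 1 < conj_part xs i")
    case True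
    \<comment> \<open>The shift is chosen so that a row \<open>k\<close> attaining it satisfies
      \<open>sp_content xs k i = 0\<close>, by the formula below the diagonal.\<close>
    show ?thesis
    proof (rule boundary_step_cases[OF s, of "- (int (part xs i) - int i + 2)"])
      fix k assume k: "1 \<le> k" "int (part xs k) - int k = - (int (part xs i) - int i + 2)"
      have "i < k" using k i anti[of k i] by linarith
      moreover have "i \<le> part xs k"
        using conj[of k i] k i True by linarith
      ultimately show ?thesis
        using k i by (intro that[of k i]) (auto simp: mem_cells_iff sp_content_def)
    next
      fix k assume k: "1 \<le> k"
        "int (conj_part xs k) - int k = - (- (int (part xs i) - int i + 2)) - 1"
      have "i < k" using k i True conj_anti[of k i] by linarith
      moreover have "k \<le> part xs k" using conj[of k k] k i by linarith
      ultimately show ?thesis using max[of k] anti[of i k] k i by linarith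
    qed
  next
    case False
    \<comment> \<open>Here a column \<open>k\<close> attaining the complementary value
      \<open>-t - 1\<close> gives \<open>sp_content xs i k = 0\<close>, by the formula for
      \<open>i \<le> k\<close>.\<close>
    show ?thesis
    proof (rule boundary_step_cases[OF s, of "int (conj_part xs i) - int i - 1"])
      fix k assume k: "1 \<le> k"
        "int (conj_part xs k) - int k = - (int (conj_part xs i) - int i - 1) - 1"
      have "i \<le> k" using k i conj_anti[of k i] by linarith
      moreover have "k \<le> part xs i"
        using conj[of i k] k i False ne by linarith
      ultimately show ?thesis
        using k i by (intro that[of i k]) (auto simp: mem_cells_iff sp_content_def)
    next
      fix k assume k: "1 \<le> k" "int (part xs k) - int k = int (conj_part xs i) - int i - 1"
      show ?thesis
      \<comment> \<open>If column \<open>i\<close> ends on the diagonal, the cell (i, i) itself has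
        content 0. Otherwise row \<open>k\<close> reaches the diagonal, and balance at (k, k) would
        make column \<open>k\<close> longer than column \<open>i\<close>.\<close>
      proof (cases "conj_part xs i = i")
        case True
        then show ?thesis using i by (intro that[of i i]) (auto simp: mem_cells_iff sp_content_def)
      next
        case False
        have "i < k" using k i \<open>\<not> part xs i + 1 < conj_part xs i\<close> ne anti[of k i] by linarith
        moreover have "k \<le> part xs k" using k i False by linarith
        ultimately show ?thesis using max[of k] conj_anti[of i k] k i by linarith
      qed
    qed
  qed
qed

text \<open>In a balanced partition \<open>(i, j) \<mapsto> (j + 1, i)\<close> maps the cells with \<open>i \<le> j\<close> bijectively
  onto those below the diagonal.\<close>

lemma card_upper_cells:
  assumes "sorted_wrt (\<ge>) xs" "balanced xs"
  shows "sum_list xs = 2 * card {(i, j) \<in> cells xs. i \<le> j}"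
proof -
  define U where "U = {(i, j) \<in> cells xs. i \<le> j}"
  define L where "L = {(i, j) \<in> cells xs. j < i}"
  note conj = le_conj_part_iff[OF assms(1)]
  have bal: "conj_part xs i = part xs i + 1" if "1 \<le> i" "i \<le> part xs i" for i
    using assms(2) that by (auto simp: balanced_def mem_cells_iff)
  have "bij_betw (\<lambda>(i, j). (Suc j, i)) U L"
  proof (rule bij_betwI[of _ _ _ "\<lambda>(k, i). (i, k - 1)"])
    show "(\<lambda>(i, j). (Suc j, i)) \<in> U \<rightarrow> L"
    proof clarify
      fix i j assume "(i, j) \<in> U"
      then have ij: "1 \<le> i" "i \<le> j" "j \<le> part xs i" by (auto simp: U_def cells_def)
      then have "Suc j \<le> conj_part xs i" using bal[of i] by simp
      then show "(Suc j, i) \<in> L"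
        using conj[of "Suc j" i] ij by (simp add: L_def mem_cells_iff)
    qed
    show "(\<lambda>(k, i). (i, k - 1)) \<in> L \<rightarrow> U"
    proof clarify
      fix k i assume "(k, i) \<in> L"
      then have ki: "1 \<le> i" "i < k" "k \<le> conj_part xs i"
        using conj[of k i] by (auto simp: L_def cells_def)
      then have "k \<le> part xs i + 1" using bal[of i] conj[of i i] by simp
      then show "(i, k - 1) \<in> U" using ki by (auto simp: U_def mem_cells_iff)
    qed
  qed (auto simp: U_def L_def)
  then have "card U = card L" by (rule bij_betw_same_card)
  moreover have "cells xs = U \<union> L" "U \<inter> L = {}" by (auto simp: U_def L_def)
  moreover from this have "finite U" "finite L" using finite_cells[of xs] by auto
  ultimately have "card (cells xs) = 2 * card U" by (simp add: card_Un_disjoint)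
  then show ?thesis by (simp add: card_cells U_def)
qed

lemma prod_sp_content_hook:
  assumes "xs \<in> partitions_of n"
  shows "(\<Prod>(i, j)\<in>cells xs. rat_of_int (sp_content xs i j) / rat_of_int (hook xs i j))
    = (if balanced xs then (- 1) ^ (n div 2) else 0)"
proof (cases "balanced xs")
  case True
  have s: "sorted_wrt (\<ge>) xs" and n: "sum_list xs = n"
    using assms by (simp_all add: partitions_of_def)
  have "(\<Prod>(i, j)\<in>cells xs. rat_of_int (sp_content xs i j) / rat_of_int (hook xs i j))
    = (\<Prod>(i, j)\<in>cells xs. if i \<le> j then - 1 else 1)"
    using hook_pos[OF s] sp_content_eq_hook[OF s True]
    by (intro prod.cong) (force split: prod.splits)+
  also have "\<dots> = (\<Prod>u\<in>cells xs. if fst u \<le> snd u then - 1 else 1)"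
    by (simp add: case_prod_beta)
  also have "\<dots> = (- 1) ^ card {u \<in> cells xs. fst u \<le> snd u}"
    by (simp add: prod.If_cases finite_cells Int_def)
  also have "{u \<in> cells xs. fst u \<le> snd u} = {(i, j) \<in> cells xs. i \<le> j}" by auto
  also have "card \<dots> = n div 2"
    using card_upper_cells[OF s True] n by simp
  finally show ?thesis using True by simp
next
  case False
  have s: "sorted_wrt (\<ge>) xs" using assms by (simp add: partitions_of_def)
  obtain i j where "(i, j) \<in> cells xs" "sp_content xs i j = 0"
    using exists_sp_content_eq_0[OF s False] .
  then have "\<exists>u\<in>cells xs. (case u of (i, j) \<Rightarrow>
      rat_of_int (sp_content xs i j) / rat_of_int (hook xs i j)) = 0"
    by (intro bexI[of _ "(i, j)"]) auto
  then show ?thesis using False by (simp add: prod_zero finite_cells)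
qed

lemma balanced_even:
  assumes "xs \<in> partitions_of n" "balanced xs"
  shows "even n"
  using card_upper_cells[of xs] assms by (auto simp: partitions_of_def)

text \<open>Transposition exchanges the two cases of the definitions. The boundaries fit because the
  diagonal belongs to the case \<open>i \<ge> j\<close> for orthogonal and to the case
  \<open>i \<le> j\<close> for symplectic contents.\<close>

lemma orth_content_eq_conjugate:
  assumes "sorted_wrt (\<ge>) xs" "(i, j) \<in> cells xs"
  shows "orth_content xs i j = - sp_content (conjugate xs) j i"
    and "hook xs i j = hook (conjugate xs) j i"
  using assms
  by (auto simp: orth_content_def sp_content_def hook_def cells_def part_conjugate conj_part_conjugate)

lemma prod_orth_content_hook:
  assumes "xs \<in> partitions_of n"
  shows "(\<Prod>(i, j)\<in>cells xs. rat_of_int (orth_content xs i j) / rat_of_int (hook xs i j))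
    = (\<Prod>(i, j)\<in>cells (conjugate xs).
        rat_of_int (sp_content (conjugate xs) i j) / rat_of_int (hook (conjugate xs) i j))"
    (is "?O = ?S")
proof -
  define g where
    "g = (\<lambda>(i, j). rat_of_int (sp_content (conjugate xs) i j) / rat_of_int (hook (conjugate xs) i j))"
  have s: "sorted_wrt (\<ge>) xs" and n: "sum_list xs = n"
    using assms by (simp_all add: partitions_of_def)
  have "?O = (\<Prod>u\<in>cells xs. - 1 * g (prod.swap u))"
    by (rule prod.cong) (auto simp: g_def orth_content_eq_conjugate[OF s])
  also have "\<dots> = (- 1) ^ n * (\<Prod>u\<in>cells xs. g (prod.swap u))"
    unfolding prod.distrib using n by (simp add: card_cells)
  also have "(\<Prod>u\<in>cells xs. g (prod.swap u)) = ?S"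
    unfolding g_def by (rule prod.reindex_bij_betw[OF bij_betw_swap_cells_conjugate[OF s]])
  \<comment> \<open>The sign is harmless: either the product vanishes or the partition is balanced
    and \<open>n\<close> is even.\<close>
  also have "(- 1) ^ n * ?S = ?S"
    using prod_sp_content_hook[OF conjugate_in_partitions_of[OF assms]]
      balanced_even[OF conjugate_in_partitions_of[OF assms]]
    by auto
  finally show ?thesis .
qed

lemma sum_orth_content_hook:
  "(\<Sum>xs\<in>partitions_of n. \<Prod>(i, j)\<in>cells xs.
      rat_of_int (orth_content xs i j) / rat_of_int (hook xs i j))
    = (\<Sum>xs\<in>partitions_of n. \<Prod>(i, j)\<in>cells xs.
      rat_of_int (sp_content xs i j) / rat_of_int (hook xs i j))"
  by (rule sum.reindex_bij_witness[of _ conjugate conjugate])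
     (auto simp: conjugate_in_partitions_of prod_orth_content_hook,
      auto simp: partitions_of_def conjugate_conjugate)

section \<open>The generating function of balanced partitions\<close>

text \<open>Bounding the largest part rather than the size makes each increase of \<open>N\<close>
  correspond to one factor \<open>1 + x ^ Suc N\<close>.\<close>

definition balanced_upto :: "nat \<Rightarrow> nat list set" where
  "balanced_upto N = {xs. sorted_wrt (\<ge>) xs \<and> (\<forall>x\<in>set xs. 0 < x) \<and> balanced xs \<and> part xs 1 \<le> N}"

text \<open>Surrounds a partition with at most \<open>s\<close> rows by a hook with arm \<open>s - 1\<close> and leg \<open>s\<close>.\<close>

definition add_hook :: "nat \<Rightarrow> nat list \<Rightarrow> nat list" where
  "add_hook s ys = s # map Suc ys @ replicate (s - length ys) 1"

text \<open>This is balance at the cell (1, 1), since column 1 contains all rows. The first part s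
  thus fixes the first hook: arm s - 1, leg s, 2s cells.\<close>

lemma length_balanced:
  assumes "sorted_wrt (\<ge>) xs" "balanced xs" "\<forall>x\<in>set xs. 0 < x" "xs \<noteq> []"
  shows "length xs = Suc (part xs 1)"
proof -
  have "(1, 1) \<in> cells xs"
    using assms(3,4) by (cases xs) (auto simp: mem_cells_iff part_def)
  then have "conj_part xs 1 = Suc (part xs 1)" using assms(2) by (auto simp: balanced_def)
  moreover have "{i. (i, 1) \<in> cells xs} = {1..length xs}"
    using assms(3) by (auto simp: cells_def part_def Suc_le_eq)
  ultimately show ?thesis by (simp add: conj_part_def)
qed

lemma sorted_add_hook:
  assumes "sorted_wrt (\<ge>) ys" "part ys 1 < s"
  shows "sorted_wrt (\<ge>) (add_hook s ys)"
proof -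
  have "y < s" if "y \<in> set ys" for y
    using assms that by (cases ys) (auto simp: part_def)
  then show ?thesis using assms(1)
    by (auto simp: add_hook_def sorted_wrt_append sorted_wrt_map Suc_le_eq less_Suc_eq_le
        sorted_wrt_iff_nth_less[of _ "replicate _ _"])
qed

text \<open>The padding by ones makes the second formula valid also for rows beyond
  \<open>ys\<close>, where \<open>part ys i\<close> is 0.\<close>

lemma part_add_hook:
  assumes "length ys \<le> s"
  shows "part (add_hook s ys) 1 = s"
    and "1 \<le> i \<Longrightarrow> part (add_hook s ys) (Suc i) = (if i \<le> s then Suc (part ys i) else 0)"
  using assms by (auto simp: part_def add_hook_def nth_append)

text \<open>The new column is column \<open>j\<close> of \<open>ys\<close> moved down by one, with a
  cell of row 1 on top; \<open>j < s\<close> ensures that row 1 extends that far.\<close>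

lemma conj_part_add_hook:
  assumes "length ys \<le> s" "1 \<le> j" "j < s"
  shows "conj_part (add_hook s ys) (Suc j) = Suc (conj_part ys j)"
proof -
  have fin: "finite {i. (i, j) \<in> cells ys}"
    by (rule finite_subset[of _ "{1..length ys}"]) (auto simp: cells_def)
  have "(i, Suc j) \<in> cells (add_hook s ys) \<longleftrightarrow> i \<in> insert 1 (Suc ` {i. (i, j) \<in> cells ys})" for i
  proof -
    consider "i = 0" | "i = 1" | k where "i = Suc k" "1 \<le> k"
      by (cases i) (auto simp: Suc_le_eq)
    then show ?thesis
    proof cases
      case 3
      then show ?thesis
        using assms part_add_hook(2)[OF assms(1), of k]
        by (auto simp: mem_cells_iff part_def split: if_splits)
    qed (use assms part_add_hook(1)[OF assms(1)] in \<open>auto simp: mem_cells_iff part_def\<close>)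
  qed
  then have "{i. (i, Suc j) \<in> cells (add_hook s ys)} = insert 1 (Suc ` {i. (i, j) \<in> cells ys})"
    by blast
  moreover have "1 \<notin> Suc ` {i. (i, j) \<in> cells ys}" by (auto simp: cells_def)
  ultimately show ?thesis using fin by (simp add: conj_part_def card_image)
qed

text \<open>The new hook is balanced at (1, 1) by construction. The other diagonal cells are those
  of \<open>ys\<close> shifted by one, with row and column both lengthened by one.\<close>

lemma balanced_add_hook_iff:
  assumes "sorted_wrt (\<ge>) ys" "length ys \<le> s" "part ys 1 < s"
  shows "balanced (add_hook s ys) \<longleftrightarrow> balanced ys"
proof -
  have "(i, 1) \<in> cells (add_hook s ys) \<longleftrightarrow> i \<in> {1..Suc s}" for i
  proof -
    consider "i = 0" | "i = 1" | k where "i = Suc k" "1 \<le> k"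
      by (cases i) (auto simp: Suc_le_eq)
    then show ?thesis
      using part_add_hook[OF assms(2)] assms(3)
      by cases (auto simp: mem_cells_iff part_def[of _ 0])
  qed
  then have "{i. (i, 1) \<in> cells (add_hook s ys)} = {1..Suc s}" by blast
  then have 1: "conj_part (add_hook s ys) 1 = part (add_hook s ys) 1 + 1"
    unfolding conj_part_def part_add_hook(1)[OF assms(2)] by simp
  \<comment> \<open>Diagonal cells of \<open>ys\<close> lie in columns before \<open>s\<close>, as
    \<open>conj_part_add_hook\<close> demands.\<close>
  have lt: "i < s" if "1 \<le> i" "i \<le> part ys i" for i
    using that part_antimono[OF assms(1), of 1 i] assms(3) by simp
  have Suc: "(Suc i, Suc i) \<in> cells (add_hook s ys) \<longleftrightarrow> (i, i) \<in> cells ys" if "1 \<le> i" for i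
    using that part_add_hook(2)[OF assms(2), of i] lt[of i] by (auto simp: mem_cells_iff)
  have eq: "conj_part (add_hook s ys) (Suc i) = part (add_hook s ys) (Suc i) + 1
      \<longleftrightarrow> conj_part ys i = part ys i + 1" if "(i, i) \<in> cells ys" for i
  proof -
    have "1 \<le> i" "i < s" using that lt[of i] by (auto simp: mem_cells_iff)
    then show ?thesis
      using conj_part_add_hook[OF assms(2), of i] part_add_hook(2)[OF assms(2), of i] by simp
  qed
  show ?thesis
  proof
    assume *: "balanced (add_hook s ys)"
    show "balanced ys" unfolding balanced_def
    proof (intro allI impI)
      fix i assume i: "(i, i) \<in> cells ys"
      then have "(Suc i, Suc i) \<in> cells (add_hook s ys)" using Suc[of i] by (simp add: mem_cells_iff)
      then show "conj_part ys i = part ys i + 1" using * eq[OF i] by (simp add: balanced_def)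
    qed
  next
    assume *: "balanced ys"
    show "balanced (add_hook s ys)" unfolding balanced_def
    proof (intro allI impI)
      fix k assume k: "(k, k) \<in> cells (add_hook s ys)"
      consider "k = 1" | i where "k = Suc i" "1 \<le> i"
        using k by (cases k) (auto simp: mem_cells_iff Suc_le_eq)
      then show "conj_part (add_hook s ys) k = part (add_hook s ys) k + 1"
      proof cases
        case 2
        then have "(i, i) \<in> cells ys" using k Suc by simp
        then show ?thesis using * eq[of i] 2 by (simp add: balanced_def)
      qed (use 1 in simp)
    qed
  qed
qed

lemma inj_add_hook: "inj_on (add_hook s) {ys. (\<forall>y\<in>set ys. 0 < y) \<and> length ys \<le> s}"
proof (rule inj_onI)
  fix xs ys
  assume xs: "xs \<in> {ys. (\<forall>y\<in>set ys. 0 < y) \<and> length ys \<le> s}"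
    and ys: "ys \<in> {ys. (\<forall>y\<in>set ys. 0 < y) \<and> length ys \<le> s}"
    and eq: "add_hook s xs = add_hook s ys"
  show "xs = ys"
  proof (rule partition_eqI)
    fix i :: nat assume "1 \<le> i"
    then show "part xs i = part ys i"
      using part_add_hook(2)[of xs s i] part_add_hook(2)[of ys s i] xs ys eq
      by (cases "i \<le> s") (auto simp: part_def)
  qed (use xs ys in auto)
qed

text \<open>In a decreasing list the ones form the tail, and all earlier parts stay positive when
  lowered. This removes the first column and prepares the inverse of
  \<open>add_hook\<close>.\<close>

lemma partition_decompose:
  assumes "sorted_wrt (\<ge>) xs" "\<forall>x\<in>set xs. (0::nat) < x"
  shows "\<exists>ys k. xs = map Suc ys @ replicate k 1 \<and> sorted_wrt (\<ge>) ys \<and> (\<forall>y\<in>set ys. 0 < y)"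
  using assms
proof (induction xs)
  case (Cons x xs)
  show ?case
  proof (cases "x = 1")
    case True
    have "y = 1" if "y \<in> set xs" for y using Cons.prems True that by force
    then obtain k where "xs = replicate k 1" using replicate_length_same[of xs 1] by metis
    with True have "x # xs = map Suc [] @ replicate (Suc k) 1" by simp
    then show ?thesis by (intro exI[of _ "[]"] exI[of _ "Suc k"]) simp
  next
    case False
    obtain ys k where ys: "xs = map Suc ys @ replicate k 1" "sorted_wrt (\<ge>) ys" "\<forall>y\<in>set ys. 0 < y"
      using Cons.IH Cons.prems(1,2) by (metis list.set_intros(2) sorted_wrt.simps(2))
    obtain z where z: "x = Suc z" "0 < z" using False Cons.prems(2) by (cases x) auto
    have "\<forall>y\<in>set ys. y \<le> z" using Cons.prems(1) ys(1) z(1) by auto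
    then have "x # xs = map Suc (z # ys) @ replicate k 1"
      "sorted_wrt (\<ge>) (z # ys)" "\<forall>y\<in>set (z # ys). 0 < y"
      using ys z by simp_all
    then show ?thesis by blast
  qed
qed simp

text \<open>Hence the subtraction in \<open>add_hook (Suc N)\<close> is never truncated on
  \<open>balanced_upto N\<close>.\<close>

lemma balanced_upto_length:
  assumes "ys \<in> balanced_upto N"
  shows "length ys \<le> Suc N"
  using assms length_balanced[of ys] by (cases "ys = []") (auto simp: balanced_upto_def)

lemma balanced_upto_0: "balanced_upto 0 = {[]}"
proof -
  have "xs = []" if "\<forall>x\<in>set xs. 0 < x" "part xs 1 = 0" for xs
    using that by (cases xs) (auto simp: part_def)
  then show ?thesis by (auto simp: balanced_upto_def balanced_def cells_def part_def)
qed

text \<open>A member with largest part \<open>Suc N\<close> has a first hook of arm \<open>N\<close>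
  and leg \<open>Suc N\<close>; removing it leaves a member of
  \<open>balanced_upto N\<close>.\<close>

lemma balanced_upto_Suc:
  "balanced_upto (Suc N) = balanced_upto N \<union> add_hook (Suc N) ` balanced_upto N"
proof (intro equalityI subsetI)
  fix xs assume xs: "xs \<in> balanced_upto (Suc N)"
  show "xs \<in> balanced_upto N \<union> add_hook (Suc N) ` balanced_upto N"
  proof (cases "part xs 1 \<le> N")
    case True
    then show ?thesis using xs by (simp add: balanced_upto_def)
  next
    case False
    then have p: "part xs 1 = Suc N" using xs by (simp add: balanced_upto_def)
    then obtain zs where zs: "xs = Suc N # zs" by (cases xs) (auto simp: part_def)
    have len: "length zs = Suc N"
      using length_balanced[of xs] xs p zs by (simp add: balanced_upto_def)
    have zs_part: "sorted_wrt (\<ge>) zs" "\<forall>z\<in>set zs. 0 < z"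
      using xs zs by (simp_all add: balanced_upto_def)
    obtain ys k where ys: "zs = map Suc ys @ replicate k 1" "sorted_wrt (\<ge>) ys" "\<forall>y\<in>set ys. 0 < y"
      using partition_decompose[OF zs_part] by blast
    \<comment> \<open>Comparing lengths in \<open>zs\<close> forces
      \<open>k = Suc N - length ys\<close>, the padding used by \<open>add_hook\<close>.\<close>
    have eq: "xs = add_hook (Suc N) ys" using zs ys(1) len by (auto simp: add_hook_def)
    have "\<forall>z\<in>set zs. z \<le> Suc N" using xs zs by (simp add: balanced_upto_def)
    then have lt: "part ys 1 < Suc N" unfolding ys(1) by (cases ys) (simp_all add: part_def)
    have "length ys \<le> Suc N" using arg_cong[OF ys(1), of length] len by simp
    moreover have "balanced (add_hook (Suc N) ys)" using xs eq by (simp add: balanced_upto_def)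
    ultimately have "balanced ys" using balanced_add_hook_iff[OF ys(2) _ lt] by blast
    then have "ys \<in> balanced_upto N" using ys(2,3) lt by (simp add: balanced_upto_def)
    then show ?thesis using eq by simp
  qed
next
  fix xs assume "xs \<in> balanced_upto N \<union> add_hook (Suc N) ` balanced_upto N"
  then show "xs \<in> balanced_upto (Suc N)"
  proof
    assume "xs \<in> add_hook (Suc N) ` balanced_upto N"
    then obtain ys where ys: "ys \<in> balanced_upto N" "xs = add_hook (Suc N) ys" by blast
    then have "length ys \<le> Suc N" by (simp add: balanced_upto_length)
    then show ?thesis
      using ys part_add_hook(1)[of ys "Suc N"] balanced_add_hook_iff[of ys "Suc N"]
        sorted_add_hook[of ys "Suc N"]
      by (auto simp: balanced_upto_def) (auto simp: add_hook_def)
  qed (simp add: balanced_upto_def)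
qed

lemma finite_balanced_upto: "finite (balanced_upto N)"
  by (induction N) (simp_all add: balanced_upto_0 balanced_upto_Suc)

lemma sum_list_add_hook:
  assumes "length ys \<le> s"
  shows "sum_list (add_hook s ys) = 2 * s + sum_list ys"
proof -
  have "sum_list (map Suc ys) = sum_list ys + length ys" by (induction ys) auto
  then show ?thesis using assms by (simp add: add_hook_def sum_list_replicate)
qed

text \<open>Adding a hook of \<open>2 * Suc N\<close> cells multiplies the weight by
  \<open>x ^ Suc N\<close>. The first part separates old from new partitions.\<close>

lemma sum_balanced_upto:
  fixes x :: "'a :: comm_semiring_1"
  shows "(\<Sum>xs\<in>balanced_upto N. x ^ (sum_list xs div 2)) = (\<Prod>k=1..N. 1 + x ^ k)"
proof (induction N)
  case 0
  then show ?case by (simp add: balanced_upto_0)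
next
  case (Suc N)
  have len: "length ys \<le> Suc N" if "ys \<in> balanced_upto N" for ys
    using balanced_upto_length that by blast
  have "inj_on (add_hook (Suc N)) (balanced_upto N)"
    by (rule inj_on_subset[OF inj_add_hook]) (use len in \<open>auto simp: balanced_upto_def\<close>)
  then have "(\<Sum>xs\<in>add_hook (Suc N) ` balanced_upto N. x ^ (sum_list xs div 2))
    = (\<Sum>ys\<in>balanced_upto N. x ^ (sum_list (add_hook (Suc N) ys) div 2))"
    by (simp add: sum.reindex)
  also have "\<dots> = x ^ Suc N * (\<Prod>k=1..N. 1 + x ^ k)"
    unfolding Suc.IH[symmetric] sum_distrib_left
  proof (rule sum.cong[OF refl])
    fix ys assume "ys \<in> balanced_upto N"
    then have "sum_list (add_hook (Suc N) ys) div 2 = Suc N + sum_list ys div 2"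
      by (simp add: sum_list_add_hook len)
    then show "x ^ (sum_list (add_hook (Suc N) ys) div 2) = x ^ Suc N * x ^ (sum_list ys div 2)"
      by (simp only: power_add)
  qed
  finally have new: "(\<Sum>xs\<in>add_hook (Suc N) ` balanced_upto N. x ^ (sum_list xs div 2))
    = x ^ Suc N * (\<Prod>k=1..N. 1 + x ^ k)" .
  have "add_hook (Suc N) ys \<notin> balanced_upto N" if "ys \<in> balanced_upto N" for ys
    using part_add_hook(1)[OF len[OF that]] by (simp add: balanced_upto_def)
  then have "balanced_upto N \<inter> add_hook (Suc N) ` balanced_upto N = {}" by blast
  then have "(\<Sum>xs\<in>balanced_upto (Suc N). x ^ (sum_list xs div 2))
    = (\<Prod>k=1..N. 1 + x ^ k) + x ^ Suc N * (\<Prod>k=1..N. 1 + x ^ k)"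
    unfolding balanced_upto_Suc
    by (subst sum.union_disjoint) (simp_all only: finite_balanced_upto finite_imageI Suc.IH new)
  also have "\<dots> = (\<Prod>k=1..N. 1 + x ^ k) * (1 + x ^ Suc N)"
    by (subst mult.commute[of "x ^ Suc N"]) (simp only: distrib_left mult_1_right)
  also have "\<dots> = (\<Prod>k=1..Suc N. 1 + x ^ k)"
    by (subst prod.nat_ivl_Suc') (simp_all only: mult.commute le_add1 One_nat_def Suc_le_mono le0)
  finally show ?case .
qed

section \<open>Euler's product identity\<close>

text \<open>The odd and even factors on the left combine to the product of all
  \<open>1 - x ^ k\<close> with k up to 2M, and (1 + x^k)(1 - x^k) = 1 - x^(2k). Keeping the even
  factors on the left avoids division.\<close>

lemma euler_prod_identity:
  fixes x :: "'a :: comm_ring_1"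
  shows "(\<Prod>k=1..2*M. 1 + x ^ k) * (\<Prod>j<M. 1 - x ^ (2 * j + 1)) * (\<Prod>k=1..M. 1 - x ^ (2 * k))
    = (\<Prod>k=1..2*M. 1 - x ^ (2 * k))"
proof (induction M)
  case (Suc M)
  define y where "y = x ^ (2 * M + 1)"
  define z where "z = x ^ (2 * M + 2)"
  have p: "x ^ (2 * (2 * M + 1)) = y * y" "x ^ (2 * (2 * M + 2)) = z * z"
    unfolding y_def z_def power_add[symmetric] by (simp_all only: mult_2)
  have s: "(\<Prod>k=1..2 * Suc M. f k) = (\<Prod>k=1..2 * M. f k) * f (2 * M + 1) * f (2 * M + 2)"
    for f :: "nat \<Rightarrow> 'a" by (simp add: mult.assoc)
  have t: "(\<Prod>k=1..Suc M. 1 - x ^ (2 * k)) = (\<Prod>k=1..M. 1 - x ^ (2 * k)) * (1 - z)"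
    by (simp add: z_def)
  have u: "(\<Prod>j<Suc M. 1 - x ^ (2 * j + 1)) = (\<Prod>j<M. 1 - x ^ (2 * j + 1)) * (1 - y)"
    by (simp add: y_def)
  have "(a * (1 + y) * (1 + z)) * (b * (1 - y)) * (c * (1 - z))
      = (a * b * c) * (1 - y * y) * (1 - z * z)" for a b c :: 'a
  proof -
    have "1 - w * w = (1 + w) * (1 - w)" for w :: 'a by (simp add: algebra_simps)
    then show ?thesis by (simp only: mult_ac)
  qed
  then show ?case unfolding s t u p Suc.IH[symmetric] y_def[symmetric] z_def[symmetric] .
qed simp

section \<open>Coefficients of truncated products\<close>

lemma fps_nth_mult_prod_one_minus:
  fixes f :: "'b :: comm_ring_1 fps"
  assumes "finite A" "\<And>k. k \<in> A \<Longrightarrow> n < e k"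
  shows "(f * (\<Prod>k\<in>A. 1 - fps_X ^ e k)) $ n = f $ n"
  using assms
proof (induction A rule: finite_induct)
  case (insert a A)
  have "(f * (\<Prod>k\<in>insert a A. 1 - fps_X ^ e k)) $ n
    = (f * (\<Prod>k\<in>A. 1 - fps_X ^ e k) - f * (\<Prod>k\<in>A. 1 - fps_X ^ e k) * fps_X ^ e a) $ n"
    using insert.hyps by (simp add: algebra_simps)
  also have "\<dots> = f $ n"
    using insert by (simp add: fps_X_power_mult_right_nth)
  finally show ?case .
qed simp

text \<open>With x = -q^2, Euler's identity gives \<open>D = Q * E\<close>, where \<open>Q\<close>
  is the truncated product and \<open>E\<close> collects the factors 1 - q^(4k) with k > M, which do
  not affect coefficient \<open>n\<close>. The bound \<open>n \<le> 2 * M\<close> also ensures that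
  \<open>D\<close> counts every balanced partition of \<open>n\<close>.\<close>

lemma fps_nth_prod_balanced:
  assumes "n \<le> 2 * M"
  shows "(\<Prod>j<M. 1 / (1 + fps_X ^ (4 * Suc j - 2)) :: rat fps) $ n
    = (\<Sum>xs\<in>{xs \<in> partitions_of n. balanced xs}. (- 1) ^ (n div 2))"
proof -
  define x where "x = - (fps_X ^ 2 :: rat fps)"
  define D where "D = (\<Prod>k=1..2*M. 1 + x ^ k)"
  define A where "A = (\<Prod>j<M. 1 - x ^ (2 * j + 1))"
  define B where "B = (\<Prod>k=1..M. 1 - x ^ (2 * k))"
  define E where "E = (\<Prod>k=M+1..2*M. 1 - x ^ (2 * k))"
  define Q where "Q = (\<Prod>j<M. 1 / (1 + fps_X ^ (4 * Suc j - 2)) :: rat fps)"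
  have even: "x ^ (2 * k) = fps_X ^ (4 * k)" for k
    by (simp add: x_def power_mult[symmetric])
  \<comment> \<open>Odd powers of -q^2 keep their sign, which turns 1 - x^(2k+1) into 1 +
    q^(4k+2).\<close>
  have odd: "x ^ (2 * k + 1) = - (fps_X ^ (4 * Suc k - 2))" for k
  proof -
    have "x ^ (2 * k + 1) = fps_X ^ (4 * k) * - (fps_X ^ 2)"
      by (simp only: power_add even) (simp add: x_def)
    also have "\<dots> = - (fps_X ^ (4 * k + 2))" by (simp only: power_add) simp
    finally show ?thesis by simp
  qed
  have "B * E = (\<Prod>k=1..2*M. 1 - x ^ (2 * k))"
    using prod.ub_add_nat[of 1 M "\<lambda>k. 1 - x ^ (2 * k)" M] by (simp add: B_def E_def mult_2)
  with euler_prod_identity[of x M] have "B * (D * A) = B * E"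
    by (simp add: D_def A_def B_def mult_ac)
  \<comment> \<open>Power series over the rationals form an integral domain, so a nonzero constant
    term suffices for cancelling \<open>B\<close>.\<close>
  moreover have "B \<noteq> 0"
  proof -
    have "B $ 0 = 1"
      using fps_nth_mult_prod_one_minus[of "{1..M}" 0 "\<lambda>k. 4 * k" "1 :: rat fps"]
      by (simp add: B_def even del: fps_mult_nth_0)
    then show ?thesis by auto
  qed
  ultimately have DA: "D * A = E" by simp
  have "A * Q = (\<Prod>j<M. 1)"
    unfolding A_def Q_def prod.distrib[symmetric]
  proof (rule prod.cong[OF refl])
    fix j
    define c where "c = 1 + (fps_X ^ (4 * Suc j - 2) :: rat fps)"
    have "c $ 0 = 1" by (simp add: c_def)
    then have "c * (1 / c) = 1" by (simp add: fps_divide_unit inverse_mult_eq_1')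
    then show "(1 - x ^ (2 * j + 1)) * (1 / (1 + fps_X ^ (4 * Suc j - 2))) = 1"
      unfolding odd c_def by simp
  qed
  then have "D = Q * E" using DA by (metis mult.assoc mult.commute mult.right_neutral prod.neutral_const)
  then have "Q $ n = D $ n"
    using fps_nth_mult_prod_one_minus[of "{M+1..2*M}" n "\<lambda>k. 4 * k" Q] assms
    by (simp add: E_def even)
  also have "D = (\<Sum>xs\<in>balanced_upto (2 * M). x ^ (sum_list xs div 2))"
    unfolding D_def by (rule sum_balanced_upto[symmetric])
  also have "\<dots> $ n = (\<Sum>xs\<in>balanced_upto (2 * M). if sum_list xs = n then (- 1) ^ (n div 2) else 0)"
    unfolding fps_sum_nth
  proof (rule sum.cong[OF refl])
    fix xs assume "xs \<in> balanced_upto (2 * M)"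
    \<comment> \<open>Balanced partitions have even size, so the halved exponent loses nothing and
      the power of \<open>x\<close> is a single monomial in q^2.\<close>
    then obtain k where k: "sum_list xs = 2 * k"
      using card_upper_cells[of xs] by (auto simp: balanced_upto_def)
    have "x ^ k = fps_const ((- 1) ^ k) * fps_X ^ (2 * k)"
      by (simp add: x_def power_minus[of "fps_X ^ 2"] power_mult fps_const_power[symmetric]
          fps_const_neg[symmetric] del: fps_const_power fps_const_neg)
    then show "x ^ (sum_list xs div 2) $ n = (if sum_list xs = n then (- 1) ^ (n div 2) else 0)"
      by (auto simp: k fps_X_power_nth)
  qed
  also have "\<dots> = (\<Sum>xs\<in>{xs \<in> balanced_upto (2 * M). sum_list xs = n}. (- 1) ^ (n div 2))"
    by (rule sum.inter_filter[symmetric]) (rule finite_balanced_upto)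
  also have "{xs \<in> balanced_upto (2 * M). sum_list xs = n} = {xs \<in> partitions_of n. balanced xs}"
  proof -
    have "part xs 1 \<le> sum_list xs" for xs by (cases xs) (auto simp: part_def)
    then have "part xs 1 \<le> 2 * M" if "sum_list xs = n" for xs
      using assms that order_trans by blast
    then show ?thesis by (auto simp: balanced_upto_def partitions_of_def)
  qed
  finally show ?thesis unfolding Q_def .
qed

text \<open>The shift \<open>Suc j\<close> lets the factors start at index 0. Convergence is
  asserted separately since \<open>prodinf\<close> is a definite description.\<close>

theorem theorem2p11:
  fixes P :: "nat \<Rightarrow> rat fps"
  defines "P \<equiv> (\<lambda>j. 1 / (1 + fps_X ^ (4 * Suc j - 2)))"
  shows "convergent_prod P
    \<and> Abs_fps (\<lambda>n. \<Sum>xs\<in>partitions_of n. \<Prod>(i, j)\<in>cells xs.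
          rat_of_int (sp_content xs i j) / rat_of_int (hook xs i j)) = prodinf P
    \<and> prodinf P = Abs_fps (\<lambda>n. \<Sum>xs\<in>partitions_of n. \<Prod>(i, j)\<in>cells xs.
          rat_of_int (orth_content xs i j) / rat_of_int (hook xs i j))"
proof -
  define F where "F = Abs_fps (\<lambda>n. \<Sum>xs\<in>partitions_of n. \<Prod>(i, j)\<in>cells xs.
          rat_of_int (sp_content xs i j) / rat_of_int (hook xs i j))"
  have F_nth: "F $ n = (\<Sum>xs\<in>{xs \<in> partitions_of n. balanced xs}. (- 1) ^ (n div 2))" for n
    unfolding sum.inter_filter[OF finite_partitions_of]
    by (simp add: F_def prod_sp_content_hook)
  have P_nth: "(\<Prod>j\<le>M. P j) $ n = F $ n" if "n \<le> M" for n M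
    using fps_nth_prod_balanced[of n "Suc M"] that by (simp add: P_def F_nth lessThan_Suc_atMost)
  \<comment> \<open>Convergence of power series is coefficientwise stabilisation: coefficient
    \<open>n\<close> is final once \<open>M\<close> reaches \<open>n\<close>.\<close>
  have "(\<lambda>M. \<Prod>j\<le>M. P j) \<longlonglongrightarrow> F"
  proof (rule tendsto_fpsI)
    fix n show "\<forall>\<^sub>F M in sequentially. (\<Prod>j\<le>M. P j) $ n = F $ n"
      by (rule eventually_sequentiallyI[of n]) (rule P_nth)
  qed
  \<comment> \<open>\<open>raw_has_prod\<close> demands a nonzero limit; the empty partition
    provides the constant term 1.\<close>
  moreover have "F \<noteq> 0"
  proof -
    have "{xs \<in> partitions_of 0. balanced xs} = {[]}"
    proof -
      have "xs = []" if "\<forall>x\<in>set xs. 0 < x" "sum_list xs = 0" for xs :: "nat list"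
        using that by (cases xs) auto
      then show ?thesis by (auto simp: partitions_of_def balanced_def cells_def)
    qed
    then have "F $ 0 = 1" by (simp add: F_nth)
    then show ?thesis by auto
  qed
  ultimately have "raw_has_prod P 0 F" by (simp add: raw_has_prod_def)
  then have "convergent_prod P" "prodinf P = F"
    using has_prod_unique[of P F] by (auto simp: convergent_prod_def has_prod_def)
  then show ?thesis by (simp add: F_def sum_orth_content_hook)
qed

end
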